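(* Let $S$ be a locally compact separable metric space and $m$ a Radon measure on $S$ with full support. Let $(\mathcal E,\mathcal F)$ and $(\mathcal E^n,\mathcal F^n)$, $n\ge1$, be Dirichlet forms on $L^2(S;m)$. Suppose (i) $\mathcal F^n\subset\mathcal F$ for every $n\ge1$ and $\mathcal E^n(u,u)\ge\mathcal E(u,u)$ for every $u\in\mathcal F^n$; (ii) there is a common core $\mathcal C$ for the Dirichlet forms $(\mathcal E^n,\mathcal F^n)$, $n\ge 1$, and $(\mathcal E,\mathcal F)$ such that $$\lim_{n\to\infty}\mathcal E^n(u,u)=\mathcal E(u,u)\qquad\text{for every }u\in\mathcal C.$$ Then $(\mathcal E^n,\mathcal F^n)$ converges to $(\mathcal E,\mathcal F)$ in the sense of Mosco.
   Context: Dirichlet forms are symmetric, closed and densely defined. A core of a Dirichlet form $(\mathcal E,\mathcal F)$ is, as usual, a subset of $\mathcal F\cap C_c(S)$ that is dense in $\mathcal F$ for the norm $\mathcal E_1(f,f)^{1/2}$, $\mathcal E_1(f,f)=\mathcal E(f,f)+\|f\|_2^2$, and dense in $C_c(S)$ for the uniform norm. Mosco convergence: extend quadratic forms to all of $L^2(S;m)$ by the value $+\infty$ outside their domain. A sequence of closed quadratic forms $(\mathcal E^n,\mathcal F^n)$ on $L^2(S;m)$ converges to a closed form $(\mathcal E,\mathcal F)$ in the sense of Mosco if (a) for every sequence $u_n$ converging weakly to $u$ in $L^2(S;m)$, $\liminf_n\mathcal E^n(u_n,u_n)\ge\mathcal E(u,u)$; and (b) for every $u\in L^2(S;m)$ there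 is a sequence $u_n$ converging strongly to $u$ in $L^2(S;m)$ with $\limsup_n\mathcal E^n(u_n,u_n)\le\mathcal E(u,u)$. *)

theory Defs
  imports "HOL-Analysis.Analysis"
begin

text \<open>Neither notion of regularity is extra information here: on a locally compact separable
  metric space every Borel measure that is finite on compact sets is regular.\<close>

definition radon_measure :: "'a::metric_space measure \<Rightarrow> bool" where
  "radon_measure m \<longleftrightarrow>
     sets m = sets borel \<and>
     (\<forall>K. compact K \<longrightarrow> emeasure m K < \<infinity>) \<and>
     (\<forall>U. open U \<longrightarrow> emeasure m U = (SUP K\<in>{K. compact K \<and> K \<subseteq> U}. emeasure m K)) \<and>
     (\<forall>A\<in>sets borel. emeasure m A = (INF U\<in>{U. open U \<and> A \<subseteq> U}. emeasure m U))"

definition measure_support :: "'a::metric_space measure \<Rightarrow> 'a set" where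
  "measure_support m = {x. \<forall>U. open U \<and> x \<in> U \<longrightarrow> 0 < emeasure m U}"

text \<open>\<open>L\<^sup>2(S;m)\<close> is represented by its square integrable measurable functions, not by classes;
  equality in \<open>L\<^sup>2\<close> is almost everywhere equality. Form domains are therefore required to be
  closed under almost everywhere equality, and forms to respect it.\<close>

definition L2 :: "'a measure \<Rightarrow> ('a \<Rightarrow> real) set" where
  "L2 m = {u \<in> borel_measurable m. integrable m (\<lambda>x. (u x)\<^sup>2)}"

definition L2_inner :: "'a measure \<Rightarrow> ('a \<Rightarrow> real) \<Rightarrow> ('a \<Rightarrow> real) \<Rightarrow> real" where
  "L2_inner m u v = (\<integral>x. u x * v x \<partial>m)"

definition L2_norm :: "'a measure \<Rightarrow> ('a \<Rightarrow> real) \<Rightarrow> real" where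
  "L2_norm m u = sqrt (L2_inner m u u)"

definition L2_strong_conv ::
    "'a measure \<Rightarrow> (nat \<Rightarrow> 'a \<Rightarrow> real) \<Rightarrow> ('a \<Rightarrow> real) \<Rightarrow> bool" where
  "L2_strong_conv m u v \<longleftrightarrow>
     (\<forall>n. u n \<in> L2 m) \<and> v \<in> L2 m \<and> (\<lambda>n. L2_norm m (\<lambda>x. u n x - v x)) \<longlonglongrightarrow> 0"

definition L2_weak_conv ::
    "'a measure \<Rightarrow> (nat \<Rightarrow> 'a \<Rightarrow> real) \<Rightarrow> ('a \<Rightarrow> real) \<Rightarrow> bool" where
  "L2_weak_conv m u v \<longleftrightarrow>
     (\<forall>n. u n \<in> L2 m) \<and> v \<in> L2 m \<and>
     (\<forall>g\<in>L2 m. (\<lambda>n. L2_inner m (u n) g) \<longlonglongrightarrow> L2_inner m v g)"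

text \<open>A form is a pair of a function \<open>E\<close> and a domain \<open>F\<close>; the values of \<open>E\<close> outside \<open>F\<close> carry
  no information.\<close>

definition symmetric_form ::
    "'a measure \<Rightarrow> (('a \<Rightarrow> real) \<Rightarrow> ('a \<Rightarrow> real) \<Rightarrow> real) \<Rightarrow> ('a \<Rightarrow> real) set \<Rightarrow> bool" where
  "symmetric_form m E F \<longleftrightarrow>
     F \<subseteq> L2 m \<and>
     (\<forall>u\<in>F. \<forall>v\<in>L2 m. (AE x in m. u x = v x) \<longrightarrow> v \<in> F \<and> (\<forall>w\<in>F. E u w = E v w)) \<and>
     (\<lambda>x. 0) \<in> F \<and>
     (\<forall>u\<in>F. \<forall>v\<in>F. (\<lambda>x. u x + v x) \<in> F) \<and>
     (\<forall>c. \<forall>u\<in>F. (\<lambda>x. c * u x) \<in> F) \<and>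
     (\<forall>u\<in>F. \<forall>v\<in>F. \<forall>w\<in>F. E (\<lambda>x. u x + v x) w = E u w + E v w) \<and>
     (\<forall>c. \<forall>u\<in>F. \<forall>w\<in>F. E (\<lambda>x. c * u x) w = c * E u w) \<and>
     (\<forall>u\<in>F. \<forall>v\<in>F. E u v = E v u) \<and>
     (\<forall>u\<in>F. 0 \<le> E u u)"

definition form_one ::
    "'a measure \<Rightarrow> (('a \<Rightarrow> real) \<Rightarrow> ('a \<Rightarrow> real) \<Rightarrow> real) \<Rightarrow> ('a \<Rightarrow> real) \<Rightarrow> ('a \<Rightarrow> real) \<Rightarrow> real" where
  "form_one m E u v = E u v + L2_inner m u v"

definition form_one_norm ::
    "'a measure \<Rightarrow> (('a \<Rightarrow> real) \<Rightarrow> ('a \<Rightarrow> real) \<Rightarrow> real) \<Rightarrow> ('a \<Rightarrow> real) \<Rightarrow> real" where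
  "form_one_norm m E u = sqrt (form_one m E u u)"

definition densely_defined :: "'a measure \<Rightarrow> ('a \<Rightarrow> real) set \<Rightarrow> bool" where
  "densely_defined m F \<longleftrightarrow>
     (\<forall>f\<in>L2 m. \<forall>\<epsilon>>0. \<exists>g\<in>F. L2_norm m (\<lambda>x. f x - g x) < \<epsilon>)"

text \<open>Closedness is completeness of the domain for the norm \<open>form_one_norm\<close>.\<close>

definition closed_form ::
    "'a measure \<Rightarrow> (('a \<Rightarrow> real) \<Rightarrow> ('a \<Rightarrow> real) \<Rightarrow> real) \<Rightarrow> ('a \<Rightarrow> real) set \<Rightarrow> bool" where
  "closed_form m E F \<longleftrightarrow>
     (\<forall>u. (\<forall>n::nat. u n \<in> F) \<and>
          (\<forall>\<epsilon>>0. \<exists>N. \<forall>i\<ge>N. \<forall>j\<ge>N. form_one_norm m E (\<lambda>x. u i x - u j x) < \<epsilon>) \<longrightarrow>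
          (\<exists>v\<in>F. (\<lambda>n. form_one_norm m E (\<lambda>x. u n x - v x)) \<longlonglongrightarrow> 0))"

definition markovian_form ::
    "(('a \<Rightarrow> real) \<Rightarrow> ('a \<Rightarrow> real) \<Rightarrow> real) \<Rightarrow> ('a \<Rightarrow> real) set \<Rightarrow> bool" where
  "markovian_form E F \<longleftrightarrow>
     (\<forall>u\<in>F. (\<lambda>x. min (max (u x) 0) 1) \<in> F \<and>
        E (\<lambda>x. min (max (u x) 0) 1) (\<lambda>x. min (max (u x) 0) 1) \<le> E u u)"

definition dirichlet_form ::
    "'a measure \<Rightarrow> (('a \<Rightarrow> real) \<Rightarrow> ('a \<Rightarrow> real) \<Rightarrow> real) \<Rightarrow> ('a \<Rightarrow> real) set \<Rightarrow> bool" where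
  "dirichlet_form m E F \<longleftrightarrow>
     symmetric_form m E F \<and> densely_defined m F \<and> closed_form m E F \<and> markovian_form E F"

definition Cc :: "('a::metric_space \<Rightarrow> real) set" where
  "Cc = {f. continuous_on UNIV f \<and> compact (closure {x. f x \<noteq> 0})}"

definition is_core ::
    "'a::metric_space measure \<Rightarrow> (('a \<Rightarrow> real) \<Rightarrow> ('a \<Rightarrow> real) \<Rightarrow> real) \<Rightarrow> ('a \<Rightarrow> real) set
      \<Rightarrow> ('a \<Rightarrow> real) set \<Rightarrow> bool" where
  "is_core m E F C \<longleftrightarrow>
     C \<subseteq> F \<inter> Cc \<and>
     (\<forall>f\<in>F. \<forall>\<epsilon>>0. \<exists>g\<in>C. form_one_norm m E (\<lambda>x. f x - g x) < \<epsilon>) \<and>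
     (\<forall>f\<in>Cc. \<forall>\<epsilon>>0. \<exists>g\<in>C. \<forall>x. \<bar>f x - g x\<bar> < \<epsilon>)"

definition extended_form ::
    "(('a \<Rightarrow> real) \<Rightarrow> ('a \<Rightarrow> real) \<Rightarrow> real) \<Rightarrow> ('a \<Rightarrow> real) set \<Rightarrow> ('a \<Rightarrow> real) \<Rightarrow> ereal" where
  "extended_form E F u = (if u \<in> F then ereal (E u u) else \<infinity>)"

definition mosco_converges ::
    "'a measure \<Rightarrow> (nat \<Rightarrow> ('a \<Rightarrow> real) \<Rightarrow> ('a \<Rightarrow> real) \<Rightarrow> real) \<Rightarrow> (nat \<Rightarrow> ('a \<Rightarrow> real) set)
      \<Rightarrow> (('a \<Rightarrow> real) \<Rightarrow> ('a \<Rightarrow> real) \<Rightarrow> real) \<Rightarrow> ('a \<Rightarrow> real) set \<Rightarrow> bool" where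
  "mosco_converges m En Fn E F \<longleftrightarrow>
     (\<forall>u v. L2_weak_conv m u v \<longrightarrow>
        extended_form E F v \<le> liminf (\<lambda>n. extended_form (En n) (Fn n) (u n))) \<and>
     (\<forall>v\<in>L2 m. \<exists>u. L2_strong_conv m u v \<and>
        limsup (\<lambda>n. extended_form (En n) (Fn n) (u n)) \<le> extended_form E F v)"

end

theory Submission
  imports Defs
begin

text \<open>
  The two halves of Mosco convergence are proved independently, by Hilbert space arguments in
  the form domain.

  Lower bound. Since \<open>\<E>\<^sup>n \<ge> \<E>\<close>, it suffices that the limit form \<open>\<E>\<close> alone is lower semicontinuous
  along weakly convergent sequences (\<open>extended_form_weakly_lsc\<close>). So let \<open>u\<^sub>n\<close> converge weakly to
  \<open>v\<close> with \<open>\<E>(u\<^sub>n) \<le> c\<close> infinitely often. For \<open>l \<ge> 1\<close>, closedness provides a minimizer \<open>w\<close> of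
  \<open>\<E>(w) + l \<parallel>w - v\<parallel>\<^sup>2\<close>, namely the resolvent of the form applied to \<open>l v\<close>
  (\<open>resolvent_exists\<close>). Its Euler equation turns \<open>\<E>(u\<^sub>n, w)\<close> into the \<open>L\<^sup>2\<close> product of \<open>u\<^sub>n\<close>
  with the one fixed function \<open>l (v - w)\<close>, so that the weak limit can be taken in
  \<open>\<E>(u\<^sub>n) \<ge> 2 \<E>(u\<^sub>n, w) - \<E>(w)\<close>. The result is \<open>\<E>(w) + 2 l \<parallel>w - v\<parallel>\<^sup>2 \<le> c\<close>
  (\<open>sublevel_set_weak_approx\<close>): elements of the sublevel set \<open>\<E> \<le> c\<close> come arbitrarily close to
  \<open>v\<close> in norm. Among those at distance \<open>O(n\<^sup>-\<^sup>1\<^sup>/\<^sup>2)\<close> of \<open>v\<close>, choose one that nearly minimizes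
  \<open>\<E>\<^sub>1\<close>; by the parallelogram law these choices form an \<open>\<E>\<^sub>1\<close>-Cauchy sequence, and its
  limit can only be \<open>v\<close>. Hence \<open>\<E>(v) \<le> c\<close>. The route through the resolvent uses completeness
  of the form domain in place of weak compactness or uniform boundedness in \<open>L\<^sup>2\<close>.

  Recovery sequence. Elements of the common core converge to \<open>v\<close> in \<open>\<E>\<^sub>1\<close>, and on each of
  them \<open>\<E>\<^sup>n\<close> converges to \<open>\<E>\<close>; a diagonal choice yields the sequence
  (\<open>core_recovery_sequence\<close>).
\<close>

section \<open>Nearly minimizing sequences and diagonal sequences\<close>

lemma quadratic_nonneg_imp_discriminant_le:
  fixes a b c :: real
  assumes c_nonneg: "0 \<le> c" and nonneg: "\<And>t. 0 \<le> a + 2 * t * b + t\<^sup>2 * c"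
  shows "b\<^sup>2 \<le> a * c"
proof (cases "c = 0")
  case True
  have "b = 0"
  proof (rule ccontr)
    assume b: "b \<noteq> 0"
    define t where "t = - (a + 1) / (2 * b)"
    have "2 * t * b = - (a + 1)" using b by (simp add: t_def)
    then show False
      using nonneg[of t] True by simp
  qed
  then show ?thesis using True by simp
next
  case False
  then have "0 < c" using c_nonneg by simp
  then show ?thesis
    using nonneg[of "- b / c"] by (simp add: field_simps power2_eq_square)
qed

text \<open>
  The projection argument of Hilbert space theory, for a shrinking family of sets instead of one
  convex set. If \<open>D a b\<close> measures how far the midpoint of \<open>a\<close> and \<open>b\<close> improves on the average
  of \<open>J\<close> (a quarter of the squared distance, by the parallelogram law), then near minimizers
  of \<open>J\<close> on \<open>A N\<close> are close to each other. The infima over the \<open>A n\<close> increase and stay bounded,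
  hence converge, so near minimizers on later sets are also near minimizers on \<open>A N\<close>.
\<close>
lemma decseq_near_minimizers_Cauchy:
  fixes A :: "nat \<Rightarrow> 'b set" and J :: "'b \<Rightarrow> real" and D :: "'b \<Rightarrow> 'b \<Rightarrow> real"
  assumes dec: "decseq A"
    and J_nonneg: "\<And>w. w \<in> A 0 \<Longrightarrow> 0 \<le> J w"
    and J_bounded: "\<And>n. \<exists>w\<in>A n. J w \<le> B"
    and midpoint: "\<And>n a b. a \<in> A n \<Longrightarrow> b \<in> A n \<Longrightarrow> \<exists>c\<in>A n. J c + D a b \<le> (J a + J b) / 2"
  obtains w where "\<And>n. w n \<in> A n" "\<And>n. J (w n) \<le> Inf (J ` A n) + 1 / real (Suc n)"
    "\<And>\<epsilon>. 0 < \<epsilon> \<Longrightarrow> \<exists>N. \<forall>i\<ge>N. \<forall>j\<ge>N. D (w i) (w j) < \<epsilon>"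
proof -
  define d where "d n = Inf (J ` A n)" for n
  have sub: "A j \<subseteq> A i" if "i \<le> j" for i j
    using dec that by (auto dest: decseqD)
  have bdd: "bdd_below (J ` A n)" for n
    using J_nonneg sub[of 0 n] by (intro bdd_belowI[of _ 0]) auto
  have ne: "A n \<noteq> {}" for n using J_bounded[of n] by auto
  have d_le: "d n \<le> J a" if "a \<in> A n" for a n
    unfolding d_def using bdd that by (intro cInf_lower) auto
  have "\<exists>a\<in>A n. J a < d n + 1 / real (Suc n)" for n
    using cInf_lessD[of "J ` A n" "d n + 1 / real (Suc n)"] ne[of n] unfolding d_def by auto
  then obtain w where w: "\<And>n. w n \<in> A n" "\<And>n. J (w n) < d n + 1 / real (Suc n)"
    by metis
  have inc: "incseq d"
    unfolding d_def by (intro monoI cInf_superset_mono image_mono sub bdd) (use ne in auto)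
  have dB: "d n \<le> B" for n using J_bounded[of n] d_le[of _ n] by fastforce
  obtain l where l: "d \<longlonglongrightarrow> l" "\<And>n. d n \<le> l"
    using incseq_convergent[OF inc] dB by metis
  have gap: "(\<lambda>n. l - d n + 1 / real (Suc n)) \<longlonglongrightarrow> 0"
    using tendsto_add[OF tendsto_diff[OF tendsto_const[of l] l(1)] LIMSEQ_inverse_real_of_nat]
    by (simp add: inverse_eq_divide)
  have "\<exists>N. \<forall>i\<ge>N. \<forall>j\<ge>N. D (w i) (w j) < \<epsilon>" if \<epsilon>: "0 < \<epsilon>" for \<epsilon>
  proof -
    obtain N where N: "l - d N + 1 / real (Suc N) < \<epsilon>"
      using order_tendstoD(2)[OF gap \<epsilon>] by (auto simp: eventually_sequentially)
    have J_le: "J (w i) \<le> l + 1 / real (Suc N)" if "N \<le> i" for i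
    proof -
      have "1 / real (Suc i) \<le> 1 / real (Suc N)"
        using that by (intro divide_left_mono) auto
      then show ?thesis using w(2)[of i] l(2)[of i] by linarith
    qed
    have "D (w i) (w j) < \<epsilon>" if ij: "N \<le> i" "N \<le> j" for i j
    proof -
      obtain c where c: "c \<in> A N" "J c + D (w i) (w j) \<le> (J (w i) + J (w j)) / 2"
        using midpoint[of "w i" N "w j"] w(1) sub ij by blast
      then show ?thesis
        using J_le[OF ij(1)] J_le[OF ij(2)] d_le[OF c(1)] N by argo
    qed
    then show ?thesis by blast
  qed
  moreover have "J (w n) \<le> Inf (J ` A n) + 1 / real (Suc n)" for n
    using w(2)[of n] by (simp add: d_def)
  ultimately show ?thesis using that[of w] w(1) by blast
qed

text \<open>
  Let \<open>\<kappa> n\<close> be the largest \<open>k \<le> n\<close> whose threshold \<open>N k\<close> has been reached at time \<open>n\<close>.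
\<close>
lemma eventually_sequentially_diagonal:
  fixes P :: "nat \<Rightarrow> nat \<Rightarrow> bool"
  assumes "\<And>k. eventually (P k) sequentially"
  obtains \<kappa> where "filterlim \<kappa> at_top sequentially" "eventually (\<lambda>n. P (\<kappa> n) n) sequentially"
proof -
  obtain N where N: "\<And>k n. N k \<le> n \<Longrightarrow> P k n"
    using assms unfolding eventually_sequentially by metis
  define S where "S n = {k. k \<le> n \<and> N k \<le> n}" for n
  define \<kappa> where "\<kappa> n = Max (S n)" for n
  have fin: "finite (S n)" for n unfolding S_def by simp
  have "K \<le> \<kappa> n" if "max K (N K) \<le> n" for K n
    unfolding \<kappa>_def using that by (intro Max_ge fin) (auto simp: S_def)
  then have "filterlim \<kappa> at_top sequentially"
    unfolding filterlim_at_top eventually_sequentially by meson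
  moreover have "P (\<kappa> n) n" if "N 0 \<le> n" for n
  proof -
    have "0 \<in> S n" using that by (simp add: S_def)
    then have "\<kappa> n \<in> S n" unfolding \<kappa>_def using fin Max_in by blast
    then show ?thesis using N by (simp add: S_def)
  qed
  then have "eventually (\<lambda>n. P (\<kappa> n) n) sequentially"
    unfolding eventually_sequentially by blast
  ultimately show ?thesis by (rule that)
qed

section \<open>Nonnegative symmetric forms\<close>

context
  fixes m :: "'a measure" and E :: "('a \<Rightarrow> real) \<Rightarrow> ('a \<Rightarrow> real) \<Rightarrow> real" and F :: "('a \<Rightarrow> real) set"
  assumes sf: "symmetric_form m E F"
begin

lemma form_add_left: "u \<in> F \<Longrightarrow> v \<in> F \<Longrightarrow> w \<in> F \<Longrightarrow> E (\<lambda>x. u x + v x) w = E u w + E v w"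
  and form_scale_left: "u \<in> F \<Longrightarrow> w \<in> F \<Longrightarrow> E (\<lambda>x. c * u x) w = c * E u w"
  and form_sym: "u \<in> F \<Longrightarrow> v \<in> F \<Longrightarrow> E u v = E v u"
  and form_nonneg: "u \<in> F \<Longrightarrow> 0 \<le> E u u"
  and form_domain_add: "u \<in> F \<Longrightarrow> v \<in> F \<Longrightarrow> (\<lambda>x. u x + v x) \<in> F"
  and form_domain_scale: "u \<in> F \<Longrightarrow> (\<lambda>x. c * u x) \<in> F"
  and form_domain_zero: "(\<lambda>x. 0) \<in> F"
  and form_domain_L2: "u \<in> F \<Longrightarrow> u \<in> L2 m"
  using sf unfolding symmetric_form_def by auto

lemma form_AE_cong:
  assumes "u \<in> F" "v \<in> L2 m" "AE x in m. u x = v x"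
  shows "v \<in> F" "E v v = E u u"
proof -
  show v: "v \<in> F" and *: "E v v = E u u"
    using sf assms unfolding symmetric_form_def by metis+
qed

lemma form_domain_diff: "u \<in> F \<Longrightarrow> v \<in> F \<Longrightarrow> (\<lambda>x. u x - v x) \<in> F"
  using form_domain_add[of u "\<lambda>x. (- 1) * v x"] form_domain_scale[of v "- 1"] by simp

lemma form_diff_left:
  "u \<in> F \<Longrightarrow> v \<in> F \<Longrightarrow> w \<in> F \<Longrightarrow> E (\<lambda>x. u x - v x) w = E u w - E v w"
  using form_add_left[of u "\<lambda>x. (- 1) * v x" w] form_domain_scale[of v "- 1"]
    form_scale_left[of v w "- 1"] by simp

lemma form_square_add_scaled:
  assumes "u \<in> F" "v \<in> F"
  shows "E (\<lambda>x. u x + t * v x) (\<lambda>x. u x + t * v x) = E u u + 2 * t * E u v + t\<^sup>2 * E v v"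
proof -
  define s where "s = (\<lambda>x. t * v x)"
  have s: "s \<in> F" unfolding s_def using assms form_domain_scale by simp
  define z where "z = (\<lambda>x. u x + s x)"
  have z: "z \<in> F" unfolding z_def using assms s form_domain_add by simp
  have "E z z = E u z + E s z"
    using form_add_left[OF assms(1) s z] by (simp add: z_def)
  also have "E s z = t * E v z"
    unfolding s_def using form_scale_left[OF assms(2) z] by simp
  also have "E u z = E u u + t * E u v"
    using form_sym[OF assms(1) z] form_add_left[OF assms(1) s assms(1)]
      form_scale_left[OF assms(2,1)] form_sym[OF assms] by (simp add: z_def s_def)
  also have "E v z = E u v + t * E v v"
    using form_sym[OF assms(2) z] form_add_left[OF assms(1) s assms(2)]
      form_scale_left[OF assms(2,2)] by (simp add: z_def s_def)
  finally show ?thesis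
    by (simp add: z_def s_def power2_eq_square algebra_simps)
qed

lemma form_square_diff:
  assumes "u \<in> F" "v \<in> F"
  shows "E (\<lambda>x. u x - v x) (\<lambda>x. u x - v x) = E u u - 2 * E u v + E v v"
  using form_square_add_scaled[OF assms, of "- 1"] by simp

lemma form_domain_midpoint:
  assumes "u \<in> F" "v \<in> F"
  shows "(\<lambda>x. (u x + v x) / 2) \<in> F"
  using form_domain_scale[OF form_domain_add[OF assms], of "1 / 2"] by simp

text \<open>
  The parallelogram law, arranged as the gain of the midpoint over the average, which is how
  \<open>decseq_near_minimizers_Cauchy\<close> consumes it.
\<close>
lemma form_midpoint:
  assumes "u \<in> F" "v \<in> F"
  shows "E (\<lambda>x. (u x + v x) / 2) (\<lambda>x. (u x + v x) / 2)
    + E (\<lambda>x. u x - v x) (\<lambda>x. u x - v x) / 4 = (E u u + E v v) / 2"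
proof -
  define h where "h = (\<lambda>x. 1 / 2 * u x)"
  have h: "h \<in> F" unfolding h_def by (rule form_domain_scale[OF assms(1)])
  have "E h h = E u u / 4" "E h v = E u v / 2"
    using form_scale_left[OF assms, of "1/2"] form_scale_left[OF assms(1) h, of "1/2"]
      form_scale_left[OF assms(1,1), of "1/2"] form_sym[OF assms(1) h]
    by (auto simp: h_def)
  moreover have "(\<lambda>x. (u x + v x) / 2) = (\<lambda>x. h x + 1 / 2 * v x)"
    by (auto simp: h_def field_simps)
  ultimately show ?thesis
    using form_square_add_scaled[OF h assms(2), of "1/2"] form_square_diff[OF assms]
    by (simp add: power2_eq_square field_simps)
qed

text \<open>This is nonnegativity of the form at \<open>u - 2 v\<close>.\<close>
lemma form_square_le:
  assumes "u \<in> F" "v \<in> F"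
  shows "E u u \<le> 2 * E (\<lambda>x. u x - v x) (\<lambda>x. u x - v x) + 2 * E v v"
proof -
  have "0 \<le> E u u - 4 * E u v + 4 * E v v"
    using form_square_add_scaled[OF assms, of "- 2"]
      form_nonneg[OF form_domain_add[OF assms(1) form_domain_scale[OF assms(2), of "- 2"]]]
    by simp
  then show ?thesis using form_square_diff[OF assms] by simp
qed

lemma form_Cauchy_Schwarz:
  assumes "u \<in> F" "v \<in> F"
  shows "(E u v)\<^sup>2 \<le> E u u * E v v"
proof (rule quadratic_nonneg_imp_discriminant_le)
  show "0 \<le> E v v" using assms(2) by (rule form_nonneg)
next
  fix t
  show "0 \<le> E u u + 2 * t * E u v + t\<^sup>2 * E v v"
    using form_square_add_scaled[OF assms, of t]
      form_nonneg[OF form_domain_add[OF assms(1) form_domain_scale[OF assms(2), of t]]]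
    by simp
qed

text \<open>
  In the expansion of \<open>E (u n)\<close> around \<open>w\<close> the mixed term is small by Cauchy-Schwarz. With the
  \<open>L\<^sup>2\<close> product as \<open>E\<close> this also covers convergence of norms.
\<close>
lemma form_square_tendsto:
  assumes "\<And>n. u n \<in> F" "w \<in> F"
    and lim: "(\<lambda>n. E (\<lambda>x. u n x - w x) (\<lambda>x. u n x - w x)) \<longlonglongrightarrow> 0"
  shows "(\<lambda>n. E (u n) (u n)) \<longlonglongrightarrow> E w w"
proof -
  define r where "r n = (\<lambda>x. u n x - w x)" for n
  have r: "r n \<in> F" for n unfolding r_def using assms form_domain_diff by simp
  have lim: "(\<lambda>n. E (r n) (r n)) \<longlonglongrightarrow> 0" using lim by (simp add: r_def)
  have "(\<lambda>n. (E (r n) w)\<^sup>2) \<longlonglongrightarrow> 0"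
  proof (rule tendsto_sandwich[OF _ _ tendsto_const])
    show "(\<lambda>n. E (r n) (r n) * E w w) \<longlonglongrightarrow> 0"
      using tendsto_mult_right[OF lim, of "E w w"] by simp
  qed (use form_Cauchy_Schwarz[OF r assms(2)] in auto)
  then have "(\<lambda>n. E (r n) w) \<longlonglongrightarrow> 0"
    using tendsto_real_sqrt[of "\<lambda>n. (E (r n) w)\<^sup>2" 0] tendsto_rabs_zero_iff by fastforce
  then have "(\<lambda>n. E w w + 2 * E (r n) w + E (r n) (r n)) \<longlonglongrightarrow> E w w + 2 * 0 + 0"
    by (intro tendsto_intros lim)
  moreover have "E (u n) (u n) = E w w + 2 * E (r n) w + E (r n) (r n)" for n
    using form_square_diff[OF assms(1) assms(2), of n] form_diff_left[OF assms(1,2,2), of n]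
    by (simp add: r_def)
  ultimately show ?thesis by simp
qed

end

section \<open>The inner product of \<open>L\<^sup>2\<close> and the form \<open>\<E>\<^sub>1\<close>\<close>

lemma L2_mult_integrable:
  assumes "u \<in> L2 m" "v \<in> L2 m"
  shows "integrable m (\<lambda>x. u x * v x)"
proof (rule Bochner_Integration.integrable_bound)
  show "integrable m (\<lambda>x. (u x)\<^sup>2 + (v x)\<^sup>2)" using assms by (auto simp: L2_def)
  show "(\<lambda>x. u x * v x) \<in> borel_measurable m" using assms by (auto simp: L2_def)
  show "AE x in m. norm (u x * v x) \<le> norm ((u x)\<^sup>2 + (v x)\<^sup>2)"
  proof (rule AE_I2)
    fix x
    have "0 \<le> (\<bar>u x\<bar> - \<bar>v x\<bar>)\<^sup>2" by simp
    then have "2 * (\<bar>u x\<bar> * \<bar>v x\<bar>) \<le> (u x)\<^sup>2 + (v x)\<^sup>2"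
      by (simp add: power2_diff)
    moreover have "0 \<le> \<bar>u x\<bar> * \<bar>v x\<bar>" by simp
    ultimately show "norm (u x * v x) \<le> norm ((u x)\<^sup>2 + (v x)\<^sup>2)"
      unfolding real_norm_def abs_mult by linarith
  qed
qed

text \<open>
  The inner product is itself a nonnegative symmetric form, so that the estimates proved for
  forms apply verbatim to \<open>\<E>\<close>, to the \<open>L\<^sup>2\<close> norm and to \<open>\<E>\<^sub>1\<close>.
\<close>
lemma symmetric_form_L2_inner: "symmetric_form m (L2_inner m) (L2 m)"
proof -
  have add: "(\<lambda>x. u x + v x) \<in> L2 m" if "u \<in> L2 m" "v \<in> L2 m" for u v
    using that L2_mult_integrable[OF that] by (auto simp: L2_def power2_sum mult.assoc)
  have scale: "(\<lambda>x. c * u x) \<in> L2 m" if "u \<in> L2 m" for u c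
    using that by (auto simp: L2_def power_mult_distrib)
  have cong: "L2_inner m u w = L2_inner m v w"
    if "u \<in> L2 m" "v \<in> L2 m" "w \<in> L2 m" "AE x in m. u x = v x" for u v w
    unfolding L2_inner_def using that by (intro integral_cong_AE) (auto simp: L2_def)
  have zero: "(\<lambda>x. 0) \<in> L2 m" by (simp add: L2_def)
  have inner_add: "L2_inner m (\<lambda>x. u x + v x) w = L2_inner m u w + L2_inner m v w"
    if "u \<in> L2 m" "v \<in> L2 m" "w \<in> L2 m" for u v w
    unfolding L2_inner_def distrib_right
    using that by (intro Bochner_Integration.integral_add L2_mult_integrable)
  have inner_scale: "L2_inner m (\<lambda>x. c * u x) w = c * L2_inner m u w" for c u w
    by (simp add: L2_inner_def mult.assoc)
  have inner_sym: "L2_inner m u v = L2_inner m v u" for u v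
    by (simp add: L2_inner_def mult.commute)
  have inner_nonneg: "0 \<le> L2_inner m u u" for u
    by (simp add: L2_inner_def)
  show ?thesis
    unfolding symmetric_form_def
    by (intro conjI ballI allI impI order_refl add scale zero inner_add inner_scale inner_sym
        inner_nonneg cong) assumption+
qed

lemmas L2_diff = form_domain_diff[OF symmetric_form_L2_inner]

lemma L2_inner_self_zero_AE:
  assumes "u \<in> L2 m" "L2_inner m u u = 0"
  shows "AE x in m. u x = 0"
  using assms integral_nonneg_eq_0_iff_AE[OF L2_mult_integrable[OF assms(1,1)]]
  by (simp add: L2_inner_def)

lemma symmetric_form_form_one:
  assumes sf: "symmetric_form m E F"
  shows "symmetric_form m (form_one m E) F"
proof -
  note s1 = sf[unfolded symmetric_form_def]
  note s2 = symmetric_form_L2_inner[of m, unfolded symmetric_form_def]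
  have sub: "u \<in> L2 m" if "u \<in> F" for u using form_domain_L2[OF sf that] .
  show ?thesis
    unfolding symmetric_form_def form_one_def
    apply (intro conjI)
    using s1 apply blast
    subgoal using s1 s2 sub by metis
    using s1 apply blast
    using s1 apply blast
    using s1 apply blast
    subgoal using form_add_left[OF sf] form_add_left[OF symmetric_form_L2_inner[of m]] sub by simp
    subgoal using form_scale_left[OF sf] form_scale_left[OF symmetric_form_L2_inner[of m]] sub
      by (simp add: distrib_left)
    subgoal using form_sym[OF sf] form_sym[OF symmetric_form_L2_inner[of m]] sub by metis
    subgoal using form_nonneg[OF sf] form_nonneg[OF symmetric_form_L2_inner[of m]] sub by simp
    done
qed

lemma closed_form_limit:
  assumes sf: "symmetric_form m E F" and cl: "closed_form m E F"
    and w: "\<And>n. w n \<in> F"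
    and Cauchy: "\<And>\<epsilon>. 0 < \<epsilon> \<Longrightarrow> \<exists>N. \<forall>i\<ge>N. \<forall>j\<ge>N.
      form_one m E (\<lambda>x. w i x - w j x) (\<lambda>x. w i x - w j x) < \<epsilon>"
  obtains z where "z \<in> F" "(\<lambda>n. E (\<lambda>x. w n x - z x) (\<lambda>x. w n x - z x)) \<longlonglongrightarrow> 0"
    "(\<lambda>n. L2_inner m (\<lambda>x. w n x - z x) (\<lambda>x. w n x - z x)) \<longlonglongrightarrow> 0"
proof -
  have "\<exists>N. \<forall>i\<ge>N. \<forall>j\<ge>N. form_one_norm m E (\<lambda>x. w i x - w j x) < \<epsilon>" if "0 < \<epsilon>" for \<epsilon>
  proof -
    have "form_one_norm m E u < \<epsilon>" if "form_one m E u u < \<epsilon>\<^sup>2" for u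
      unfolding form_one_norm_def using that \<open>0 < \<epsilon>\<close> by (intro real_less_lsqrt) auto
    then show ?thesis using Cauchy[of "\<epsilon>\<^sup>2"] that by (meson zero_less_power)
  qed
  then obtain z where z: "z \<in> F" and lim: "(\<lambda>n. form_one_norm m E (\<lambda>x. w n x - z x)) \<longlonglongrightarrow> 0"
    using cl w unfolding closed_form_def by blast
  define r where "r n = (\<lambda>x. w n x - z x)" for n
  have r: "r n \<in> F" for n unfolding r_def using form_domain_diff[OF sf w z] .
  have nn: "0 \<le> E (r n) (r n)" "0 \<le> L2_inner m (r n) (r n)" for n
    using form_nonneg[OF sf r] form_nonneg[OF symmetric_form_L2_inner form_domain_L2[OF sf r]] .
  have lim1: "(\<lambda>n. form_one m E (r n) (r n)) \<longlonglongrightarrow> 0"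
  proof -
    have "(form_one_norm m E (r n))\<^sup>2 = form_one m E (r n) (r n)" for n
      using nn[of n] by (simp add: form_one_norm_def form_one_def)
    then show ?thesis using tendsto_power[OF lim, of 2] by (simp add: r_def)
  qed
  have "(\<lambda>n. E (r n) (r n)) \<longlonglongrightarrow> 0" "(\<lambda>n. L2_inner m (r n) (r n)) \<longlonglongrightarrow> 0"
    by (rule tendsto_sandwich[OF _ _ tendsto_const lim1]; use nn in \<open>simp add: form_one_def\<close>)+
  then show ?thesis using that z by (simp add: r_def)
qed

section \<open>Weak lower semicontinuity of a closed form\<close>

text \<open>
  The functional \<open>J w = \<E>(w) + l \<parallel>w - v\<parallel>\<^sup>2\<close> satisfies the parallelogram law with the norm
  \<open>\<E>(w) + l \<parallel>w\<parallel>\<^sup>2\<close>, which dominates \<open>\<E>\<^sub>1(w)\<close> because \<open>l \<ge> 1\<close>. A minimizing sequence is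
  therefore \<open>\<E>\<^sub>1\<close>-Cauchy and closedness gives a minimizer; the conclusion is its Euler equation.
\<close>
lemma resolvent_exists:
  assumes sf: "symmetric_form m E F" and cl: "closed_form m E F"
    and v: "v \<in> L2 m" and l: "1 \<le> l"
  obtains w where "w \<in> F" "\<And>\<phi>. \<phi> \<in> F \<Longrightarrow> E w \<phi> + l * L2_inner m (\<lambda>x. w x - v x) \<phi> = 0"
proof -
  let ?L = "L2_inner m"
  note sl = symmetric_form_L2_inner[of m]
  define J where "J w = E w w + l * ?L (\<lambda>x. w x - v x) (\<lambda>x. w x - v x)" for w
  define D where "D a b = form_one m E (\<lambda>x. a x - b x) (\<lambda>x. a x - b x) / 4"
    for a b :: "'a \<Rightarrow> real"
  have FL: "u \<in> L2 m" if "u \<in> F" for u using form_domain_L2[OF sf that] .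
  have J_nonneg: "0 \<le> J w" if "w \<in> F" for w
    unfolding J_def using form_nonneg[OF sf that] form_nonneg[OF sl L2_diff[OF FL[OF that] v]] l
    by simp
  have mid: "\<exists>c\<in>F. J c + D a b \<le> (J a + J b) / 2" if ab: "a \<in> F" "b \<in> F" for a b
  proof
    let ?c = "\<lambda>x. (a x + b x) / 2"
    show "?c \<in> F" using form_domain_midpoint[OF sf ab] .
    define d where "d = ?L (\<lambda>x. a x - b x) (\<lambda>x. a x - b x)"
    have shift: "(\<lambda>x. ((a x - v x) + (b x - v x)) / 2) = (\<lambda>x. ?c x - v x)"
      "(\<lambda>x. (a x - v x) - (b x - v x)) = (\<lambda>x. a x - b x)"
      by (auto simp: field_simps)
    have "?L (\<lambda>x. ?c x - v x) (\<lambda>x. ?c x - v x) + d / 4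
      = (?L (\<lambda>x. a x - v x) (\<lambda>x. a x - v x) + ?L (\<lambda>x. b x - v x) (\<lambda>x. b x - v x)) / 2"
      using form_midpoint[OF sl L2_diff[OF FL[OF ab(1)] v] L2_diff[OF FL[OF ab(2)] v]]
      unfolding shift d_def .
    then have "l * ?L (\<lambda>x. ?c x - v x) (\<lambda>x. ?c x - v x) + l * d / 4
      = (l * ?L (\<lambda>x. a x - v x) (\<lambda>x. a x - v x) + l * ?L (\<lambda>x. b x - v x) (\<lambda>x. b x - v x)) / 2"
      by algebra
    moreover have "d \<le> l * d"
      using form_nonneg[OF sl L2_diff[OF FL FL]] ab mult_right_mono[OF l, of d] by (simp add: d_def)
    ultimately show "J ?c + D a b \<le> (J a + J b) / 2"
      using form_midpoint[OF sf ab] unfolding J_def D_def form_one_def d_def[symmetric] by argo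
  qed
  obtain w where w: "\<And>n. w n \<in> F"
    and w_min: "\<And>n. J (w n) \<le> Inf (J ` F) + 1 / real (Suc n)"
    and w_Cauchy: "\<And>\<epsilon>. 0 < \<epsilon> \<Longrightarrow> \<exists>N. \<forall>i\<ge>N. \<forall>j\<ge>N. D (w i) (w j) < \<epsilon>"
    using decseq_near_minimizers_Cauchy[of "\<lambda>_. F" J "J (\<lambda>x. 0)" D] J_nonneg mid
      form_domain_zero[OF sf] by (auto simp: decseq_def)
  have "\<exists>N. \<forall>i\<ge>N. \<forall>j\<ge>N. form_one m E (\<lambda>x. w i x - w j x) (\<lambda>x. w i x - w j x) < \<epsilon>"
    if "0 < \<epsilon>" for \<epsilon>
    using w_Cauchy[of "\<epsilon> / 4"] that by (simp add: D_def)
  then obtain z where z: "z \<in> F"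
    and zE: "(\<lambda>n. E (\<lambda>x. w n x - z x) (\<lambda>x. w n x - z x)) \<longlonglongrightarrow> 0"
    and zL: "(\<lambda>n. ?L (\<lambda>x. w n x - z x) (\<lambda>x. w n x - z x)) \<longlonglongrightarrow> 0"
    using closed_form_limit[where w = w, OF sf cl w] by blast
  have "(\<lambda>n. ?L (\<lambda>x. w n x - v x) (\<lambda>x. w n x - v x)) \<longlonglongrightarrow> ?L (\<lambda>x. z x - v x) (\<lambda>x. z x - v x)"
    by (rule form_square_tendsto[OF sl L2_diff[OF FL[OF w] v] L2_diff[OF FL[OF z] v]])
      (use zL in simp)
  then have "(\<lambda>n. J (w n)) \<longlonglongrightarrow> J z"
    unfolding J_def by (intro tendsto_intros form_square_tendsto[OF sf w z zE])
  moreover have "(\<lambda>n. Inf (J ` F) + 1 / real (Suc n)) \<longlonglongrightarrow> Inf (J ` F)"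
    using tendsto_add[OF tendsto_const LIMSEQ_inverse_real_of_nat, of "Inf (J ` F)"]
    by (simp add: inverse_eq_divide)
  ultimately have "J z \<le> Inf (J ` F)"
    using w_min by (intro LIMSEQ_le) auto
  then have z_min: "J z \<le> J u" if "u \<in> F" for u
    using cInf_lower[of "J u" "J ` F"] that J_nonneg bdd_belowI[of "J ` F" 0] by fastforce
  have "E z \<phi> + l * ?L (\<lambda>x. z x - v x) \<phi> = 0" if \<phi>: "\<phi> \<in> F" for \<phi>
  proof -
    let ?b = "E z \<phi> + l * ?L (\<lambda>x. z x - v x) \<phi>"
    \<comment> \<open>\<open>J (z + t \<phi>) - J z\<close> is a nonnegative quadratic in \<open>t\<close> without constant term, so its
      linear coefficient \<open>2 ?b\<close> vanishes.\<close>
    have "?b\<^sup>2 \<le> 0 * (E \<phi> \<phi> + l * ?L \<phi> \<phi>)"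
    proof (rule quadratic_nonneg_imp_discriminant_le)
      show "0 \<le> E \<phi> \<phi> + l * ?L \<phi> \<phi>"
        using form_nonneg[OF sf \<phi>] form_nonneg[OF sl FL[OF \<phi>]] l by simp
    next
      fix t
      let ?u = "\<lambda>x. z x + t * \<phi> x"
      have "(\<lambda>x. ?u x - v x) = (\<lambda>x. (z x - v x) + t * \<phi> x)" by auto
      then have "J ?u = J z + (2 * t * ?b + t\<^sup>2 * (E \<phi> \<phi> + l * ?L \<phi> \<phi>))"
        using form_square_add_scaled[OF sf z \<phi>, of t]
          form_square_add_scaled[OF sl L2_diff[OF FL[OF z] v] FL[OF \<phi>], of t]
        by (simp add: J_def algebra_simps)
      then show "0 \<le> 0 + 2 * t * ?b + t\<^sup>2 * (E \<phi> \<phi> + l * ?L \<phi> \<phi>)"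
        using z_min[OF form_domain_add[OF sf z form_domain_scale[OF sf \<phi>]], of t] by simp
    qed
    then show ?thesis by simp
  qed
  with z show ?thesis using that by blast
qed

text \<open>
  Take for \<open>w\<close> the resolvent. From \<open>0 \<le> \<E>(u\<^sub>n - w)\<close> and the Euler equation tested with \<open>u\<^sub>n\<close>,
  \<open>c \<ge> - 2 l \<langle>w - v, u\<^sub>n\<rangle> - \<E>(w)\<close> for infinitely many \<open>n\<close>, and weak convergence replaces \<open>u\<^sub>n\<close>
  by \<open>v\<close>. The Euler equation tested with \<open>w\<close> rewrites the limit as the left-hand side of
  the conclusion.
\<close>
lemma sublevel_set_weak_approx:
  assumes sf: "symmetric_form m E F" and cl: "closed_form m E F"
    and weak: "L2_weak_conv m u v"
    and freq: "frequently (\<lambda>n. u n \<in> F \<and> E (u n) (u n) \<le> c) sequentially"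
    and l: "1 \<le> l"
  obtains w where "w \<in> F"
    "E w w + 2 * l * L2_inner m (\<lambda>x. w x - v x) (\<lambda>x. w x - v x) \<le> c"
proof -
  let ?L = "L2_inner m"
  note sl = symmetric_form_L2_inner[of m]
  have v: "v \<in> L2 m" and u: "u n \<in> L2 m" for n using weak by (auto simp: L2_weak_conv_def)
  obtain w where w: "w \<in> F" and euler: "\<And>\<phi>. \<phi> \<in> F \<Longrightarrow> E w \<phi> + l * ?L (\<lambda>x. w x - v x) \<phi> = 0"
    using resolvent_exists[OF sf cl v l] by blast
  have wL: "w \<in> L2 m" using form_domain_L2[OF sf w] .
  define g where "g = (\<lambda>x. w x - v x)"
  have g: "g \<in> L2 m" unfolding g_def using L2_diff[OF wL v] .
  have "(\<lambda>n. ?L (u n) g) \<longlonglongrightarrow> ?L v g" using weak g by (simp add: L2_weak_conv_def)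
  then have lim: "(\<lambda>n. - 2 * l * ?L (u n) g - E w w) \<longlonglongrightarrow> - 2 * l * ?L v g - E w w"
    by (intro tendsto_intros)
  have lower: "- 2 * l * ?L (u n) g - E w w \<le> c" if "u n \<in> F \<and> E (u n) (u n) \<le> c" for n
  proof -
    have "0 \<le> E (u n) (u n) - 2 * E (u n) w + E w w"
      using that form_square_diff[OF sf, of "u n" w] form_nonneg[OF sf form_domain_diff[OF sf, of "u n" w]] w
      by simp
    then show ?thesis
      using that euler[of "u n"] form_sym[OF sf w, of "u n"] form_sym[OF sl g u, of n]
      by (simp add: g_def)
  qed
  have "- 2 * l * ?L v g - E w w \<le> c"
  proof (rule ccontr)
    assume "\<not> ?thesis"
    then have "eventually (\<lambda>n. c < - 2 * l * ?L (u n) g - E w w) sequentially"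
      using order_tendstoD(1)[OF lim] by simp
    then have "eventually (\<lambda>n. \<not> (u n \<in> F \<and> E (u n) (u n) \<le> c)) sequentially"
      by (rule eventually_mono) (use lower in fastforce)
    then show False using freq by (simp add: frequently_def)
  qed
  moreover have "l * ?L g g = l * ?L w g - l * ?L v g"
    using form_diff_left[OF sl wL v g] by (simp add: g_def right_diff_distrib)
  moreover have "E w w + l * ?L w g = 0"
    using euler[OF w] form_sym[OF sl wL g] by (simp add: g_def)
  ultimately have "E w w + 2 * l * ?L g g \<le> c"
    by (simp add: algebra_simps)
  then show ?thesis using that w by (simp add: g_def)
qed

text \<open>
  It remains to pass from norm approximations of \<open>v\<close> inside the sublevel set to \<open>v\<close> itself.
  A bound on \<open>\<E>\<^sub>1\<close> alone does not make the approximations \<open>\<E>\<^sub>1\<close>-Cauchy, but the sets \<open>A n\<close> of all sufficiently good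
  ones are convex, decreasing and bounded for \<open>\<E>\<^sub>1\<close>, so nearly \<open>\<E>\<^sub>1\<close>-minimal elements of them
  do converge.
\<close>
lemma closed_form_weakly_lsc:
  assumes sf: "symmetric_form m E F" and cl: "closed_form m E F"
    and weak: "L2_weak_conv m u v"
    and freq: "frequently (\<lambda>n. u n \<in> F \<and> E (u n) (u n) \<le> c) sequentially"
  shows "v \<in> F" "E v v \<le> c"
proof -
  let ?L = "L2_inner m"
  note sl = symmetric_form_L2_inner[of m]
  note s1 = symmetric_form_form_one[OF sf]
  have v: "v \<in> L2 m" using weak by (auto simp: L2_weak_conv_def)
  have FL: "w \<in> L2 m" if "w \<in> F" for w using form_domain_L2[OF sf that] .
  have c0: "0 \<le> c"
  proof -
    obtain n where "u n \<in> F \<and> E (u n) (u n) \<le> c" using frequently_ex[OF freq] by blast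
    then show ?thesis using form_nonneg[OF sf, of "u n"] by linarith
  qed
  define q where "q w = ?L (\<lambda>x. w x - v x) (\<lambda>x. w x - v x)" for w
  define A where "A n = {w \<in> F. E w w \<le> c \<and> q w \<le> c / real (Suc n)}" for n
  have q_nonneg: "0 \<le> q w" if "w \<in> F" for w
    unfolding q_def using form_nonneg[OF sl L2_diff[OF FL[OF that] v]] .
  have dec: "decseq A"
  proof (rule decseq_SucI)
    fix n
    have "c / real (Suc (Suc n)) \<le> c / real (Suc n)" using c0 by (intro divide_left_mono) auto
    then show "A (Suc n) \<subseteq> A n" unfolding A_def by auto
  qed
  have ne: "\<exists>w. w \<in> A n" for n
  proof -
    obtain w where w: "w \<in> F" "E w w + 2 * real (Suc n) * q w \<le> c"
      using sublevel_set_weak_approx[OF sf cl weak freq, of "real (Suc n)"] unfolding q_def by auto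
    have "0 \<le> real (Suc n) * q w" using q_nonneg[OF w(1)] by simp
    moreover have "E w w + 2 * (real (Suc n) * q w) \<le> c" using w(2) by (simp only: mult.assoc)
    ultimately have "E w w \<le> c" "real (Suc n) * q w \<le> c"
      using form_nonneg[OF sf w(1)] by linarith+
    then show ?thesis using w(1) unfolding A_def by (auto simp: field_simps)
  qed
  have J_le: "form_one m E w w \<le> c + (2 * c + 2 * ?L v v)" if "w \<in> A n" for w n
  proof -
    have "w \<in> F" "E w w \<le> c" "q w \<le> c / real (Suc n)" using that by (auto simp: A_def)
    moreover have "c / real (Suc n) \<le> c / 1" using c0 by (intro divide_left_mono) auto
    ultimately show ?thesis
      using form_square_le[OF sl FL v, of w] unfolding form_one_def q_def by linarith
  qed
  define D where "D a b = form_one m E (\<lambda>x. a x - b x) (\<lambda>x. a x - b x) / 4"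
    for a b :: "'a \<Rightarrow> real"
  have mid: "\<exists>w\<in>A n. form_one m E w w + D a b \<le> (form_one m E a a + form_one m E b b) / 2"
    if "a \<in> A n" "b \<in> A n" for n a b
  proof
    let ?c = "\<lambda>x. (a x + b x) / 2"
    have ab: "a \<in> F" "b \<in> F" using that by (auto simp: A_def)
    show "form_one m E ?c ?c + D a b \<le> (form_one m E a a + form_one m E b b) / 2"
      using form_midpoint[OF s1 ab] by (simp add: D_def)
    have shift: "(\<lambda>x. ((a x - v x) + (b x - v x)) / 2) = (\<lambda>x. ?c x - v x)"
      by (auto simp: field_simps)
    have "E ?c ?c \<le> c"
      using form_midpoint[OF sf ab] form_nonneg[OF sf form_domain_diff[OF sf ab]] that
      unfolding A_def by auto
    moreover have "q ?c \<le> (q a + q b) / 2"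
      using form_midpoint[OF sl L2_diff[OF FL[OF ab(1)] v] L2_diff[OF FL[OF ab(2)] v]]
        form_nonneg[OF sl L2_diff[OF L2_diff[OF FL[OF ab(1)] v] L2_diff[OF FL[OF ab(2)] v]]]
      unfolding shift q_def by linarith
    ultimately show "?c \<in> A n"
      using form_domain_midpoint[OF sf ab] that unfolding A_def by auto
  qed
  obtain w where w: "\<And>n. w n \<in> A n"
    and w_Cauchy: "\<And>\<epsilon>. 0 < \<epsilon> \<Longrightarrow> \<exists>N. \<forall>i\<ge>N. \<forall>j\<ge>N. D (w i) (w j) < \<epsilon>"
  proof (rule decseq_near_minimizers_Cauchy[OF dec])
    show "0 \<le> form_one m E w w" if "w \<in> A 0" for w
      using form_nonneg[OF s1] that by (simp add: A_def)
    show "\<exists>w\<in>A n. form_one m E w w \<le> c + (2 * c + 2 * ?L v v)" for n using ne J_le by blast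
  qed (rule mid, assumption+, blast)
  have wF: "w n \<in> F" for n using w by (simp add: A_def)
  have "\<exists>N. \<forall>i\<ge>N. \<forall>j\<ge>N. form_one m E (\<lambda>x. w i x - w j x) (\<lambda>x. w i x - w j x) < \<epsilon>"
    if "0 < \<epsilon>" for \<epsilon>
    using w_Cauchy[of "\<epsilon> / 4"] that by (simp add: D_def)
  then obtain z where z: "z \<in> F"
    and zE: "(\<lambda>n. E (\<lambda>x. w n x - z x) (\<lambda>x. w n x - z x)) \<longlonglongrightarrow> 0"
    and zL: "(\<lambda>n. ?L (\<lambda>x. w n x - z x) (\<lambda>x. w n x - z x)) \<longlonglongrightarrow> 0"
    using closed_form_limit[where w = w, OF sf cl wF] by blast
  have "(\<lambda>n. q (w n)) \<longlonglongrightarrow> q z"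
    unfolding q_def
    by (rule form_square_tendsto[OF sl L2_diff[OF FL[OF wF] v] L2_diff[OF FL[OF z] v]])
      (use zL in simp)
  moreover have "(\<lambda>n. q (w n)) \<longlonglongrightarrow> 0"
  proof (rule tendsto_sandwich[OF _ _ tendsto_const])
    show "(\<lambda>n. c / real (Suc n)) \<longlonglongrightarrow> 0"
      using tendsto_mult_right_zero[OF LIMSEQ_inverse_real_of_nat, of c] by (simp add: divide_inverse)
  qed (use w q_nonneg in \<open>auto simp: A_def\<close>)
  ultimately have "q z = 0" by (rule LIMSEQ_unique)
  \<comment> \<open>The limit in the form domain is only a representative of the class of \<open>v\<close>.\<close>
  then have "AE x in m. z x = v x"
    using L2_inner_self_zero_AE[OF L2_diff[OF FL[OF z] v]] by (simp add: q_def)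
  note zv = form_AE_cong[OF sf z v this]
  show "v \<in> F" using zv(1) .
  have "(\<lambda>n. E (w n) (w n)) \<longlonglongrightarrow> E z z" using form_square_tendsto[OF sf wF z zE] .
  then have "E z z \<le> c" by (rule LIMSEQ_le_const2) (use w in \<open>auto simp: A_def\<close>)
  then show "E v v \<le> c" using zv(2) by simp
qed

lemma extended_form_weakly_lsc:
  assumes sf: "symmetric_form m E F" and cl: "closed_form m E F"
    and weak: "L2_weak_conv m u v"
  shows "extended_form E F v \<le> liminf (\<lambda>n. extended_form E F (u n))"
proof (rule ccontr)
  assume "\<not> ?thesis"
  then obtain c where c: "liminf (\<lambda>n. extended_form E F (u n)) < ereal c"
    "ereal c < extended_form E F v"
    using ereal_dense2 by (metis not_le)
  have "\<not> eventually (\<lambda>n. ereal c \<le> extended_form E F (u n)) sequentially"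
    using Liminf_bounded[of "ereal c" "\<lambda>n. extended_form E F (u n)" sequentially] c(1) by auto
  then have "frequently (\<lambda>n. extended_form E F (u n) < ereal c) sequentially"
    by (simp add: frequently_def not_less)
  then have "frequently (\<lambda>n. u n \<in> F \<and> E (u n) (u n) \<le> c) sequentially"
    by (rule frequently_elim1) (auto simp: extended_form_def split: if_splits)
  then have "v \<in> F" "E v v \<le> c" using closed_form_weakly_lsc[OF sf cl weak] by auto
  then show False using c(2) by (simp add: extended_form_def)
qed

section \<open>Recovery sequences and Mosco convergence\<close>

text \<open>
  Approximate \<open>v\<close> for \<open>\<E>\<^sub>1\<close> by core elements \<open>g k\<close>. For fixed \<open>k\<close>, \<open>\<E>\<^sup>n(g k)\<close> is eventually
  below \<open>\<E>(g k) + 1 / (k + 1)\<close>, and \<open>\<E>(g k)\<close> tends to \<open>\<E>(v)\<close>; so \<open>g (\<kappa> n)\<close> works for an index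
  \<open>\<kappa> n\<close> growing slowly enough.
\<close>
lemma core_recovery_sequence:
  assumes sf: "symmetric_form m E F" and v: "v \<in> F"
    and CF: "C \<subseteq> F"
    and dense: "\<And>\<epsilon>. 0 < \<epsilon> \<Longrightarrow> \<exists>g\<in>C. form_one_norm m E (\<lambda>x. v x - g x) < \<epsilon>"
    and CFn: "eventually (\<lambda>n. C \<subseteq> Fn n) sequentially"
    and conv: "\<And>u. u \<in> C \<Longrightarrow> (\<lambda>n. En n u u) \<longlonglongrightarrow> E u u"
  obtains u where "L2_strong_conv m u v"
    "limsup (\<lambda>n. extended_form (En n) (Fn n) (u n)) \<le> ereal (E v v)"
proof -
  let ?L = "L2_inner m"
  note sl = symmetric_form_L2_inner[of m]
  have FL: "w \<in> L2 m" if "w \<in> F" for w using form_domain_L2[OF sf that] .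
  have "\<exists>g\<in>C. form_one_norm m E (\<lambda>x. v x - g x) < inverse (real (Suc k))" for k
    using dense by simp
  then obtain g where g: "\<And>k. g k \<in> C"
    and g_lt: "\<And>k. form_one_norm m E (\<lambda>x. v x - g k x) < inverse (real (Suc k))"
    by metis
  have gF: "g k \<in> F" for k using g CF by blast
  define r where "r k = (\<lambda>x. g k x - v x)" for k
  have r: "r k \<in> F" for k unfolding r_def using form_domain_diff[OF sf gF v] .
  have nn: "0 \<le> E (r n) (r n)" "0 \<le> ?L (r n) (r n)" for n
    using form_nonneg[OF sf r] form_nonneg[OF sl FL[OF r]] .
  have norm_le: "sqrt (form_one m E (r k) (r k)) \<le> inverse (real (Suc k))" for k
  proof -
    have "form_one m E (\<lambda>x. v x - g k x) (\<lambda>x. v x - g k x) = form_one m E (r k) (r k)"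
      using form_square_diff[OF symmetric_form_form_one[OF sf] v gF, of k]
        form_square_diff[OF symmetric_form_form_one[OF sf] gF v, of k]
        form_sym[OF symmetric_form_form_one[OF sf] gF v, of k] by (simp add: r_def)
    then show ?thesis using g_lt[of k] by (simp add: form_one_norm_def)
  qed
  have E_le: "sqrt (E (r k) (r k)) \<le> inverse (real (Suc k))"
    and L_le: "sqrt (?L (r k) (r k)) \<le> inverse (real (Suc k))" for k
    by (rule order_trans[OF real_sqrt_le_mono norm_le]; use nn in \<open>simp add: form_one_def\<close>)+
  have L0: "(\<lambda>k. sqrt (?L (r k) (r k))) \<longlonglongrightarrow> 0" and "(\<lambda>k. sqrt (E (r k) (r k))) \<longlonglongrightarrow> 0"
    by (rule tendsto_sandwich[OF _ _ tendsto_const LIMSEQ_inverse_real_of_nat];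
        use nn E_le L_le in simp)+
  then have "(\<lambda>k. E (r k) (r k)) \<longlonglongrightarrow> 0"
    using tendsto_power[of "\<lambda>k. sqrt (E (r k) (r k))" 0 sequentially 2] nn by simp
  then have gE: "(\<lambda>k. E (g k) (g k)) \<longlonglongrightarrow> E v v"
    using form_square_tendsto[OF sf gF v] by (simp add: r_def)
  have "eventually (\<lambda>n. En n (g k) (g k) < E (g k) (g k) + inverse (real (Suc k))) sequentially" for k
    using order_tendstoD(2)[OF conv[OF g[of k]]] by simp
  then obtain \<kappa> where \<kappa>: "filterlim \<kappa> at_top sequentially"
    and ev: "eventually (\<lambda>n. En n (g (\<kappa> n)) (g (\<kappa> n))
      < E (g (\<kappa> n)) (g (\<kappa> n)) + inverse (real (Suc (\<kappa> n)))) sequentially"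
    by (rule eventually_sequentially_diagonal)
  have "L2_strong_conv m (\<lambda>n. g (\<kappa> n)) v"
    using filterlim_compose[OF L0 \<kappa>] FL[OF gF] FL[OF v]
    by (simp add: L2_strong_conv_def L2_norm_def r_def)
  moreover have "limsup (\<lambda>n. extended_form (En n) (Fn n) (g (\<kappa> n))) \<le> ereal (E v v)"
  proof -
    have "(\<lambda>k. E (g k) (g k) + inverse (real (Suc k))) \<longlonglongrightarrow> E v v + 0"
      by (intro tendsto_add gE LIMSEQ_inverse_real_of_nat)
    then have "(\<lambda>n. ereal (E (g (\<kappa> n)) (g (\<kappa> n)) + inverse (real (Suc (\<kappa> n))))) \<longlonglongrightarrow> ereal (E v v)"
      using filterlim_compose[OF _ \<kappa>] by simp
    then have "limsup (\<lambda>n. ereal (E (g (\<kappa> n)) (g (\<kappa> n)) + inverse (real (Suc (\<kappa> n))))) = ereal (E v v)"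
      by (intro lim_imp_Limsup) auto
    moreover have "limsup (\<lambda>n. extended_form (En n) (Fn n) (g (\<kappa> n)))
      \<le> limsup (\<lambda>n. ereal (E (g (\<kappa> n)) (g (\<kappa> n)) + inverse (real (Suc (\<kappa> n)))))"
      by (rule Limsup_mono, use ev CFn in eventually_elim)
        (use g in \<open>auto simp: extended_form_def subset_iff\<close>)
    ultimately show ?thesis by simp
  qed
  ultimately show ?thesis by (rule that)
qed

theorem theorem4p3:
  fixes m :: "'a::metric_space measure"
    and E :: "('a \<Rightarrow> real) \<Rightarrow> ('a \<Rightarrow> real) \<Rightarrow> real"
    and F :: "('a \<Rightarrow> real) set"
    and En :: "nat \<Rightarrow> ('a \<Rightarrow> real) \<Rightarrow> ('a \<Rightarrow> real) \<Rightarrow> real"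
    and Fn :: "nat \<Rightarrow> ('a \<Rightarrow> real) set"
    and C :: "('a \<Rightarrow> real) set"
  assumes "locally_compact_space (euclidean :: 'a topology)"
    and "separable_space (euclidean :: 'a topology)"
    and "radon_measure m"
    and "measure_support m = UNIV"
    and "dirichlet_form m E F"
    and "\<And>n. n \<ge> 1 \<Longrightarrow> dirichlet_form m (En n) (Fn n)"
    and "\<And>n. n \<ge> 1 \<Longrightarrow> Fn n \<subseteq> F"
    and "\<And>n u. n \<ge> 1 \<Longrightarrow> u \<in> Fn n \<Longrightarrow> En n u u \<ge> E u u"
    and "is_core m E F C"
    and "\<And>n. n \<ge> 1 \<Longrightarrow> is_core m (En n) (Fn n) C"
    and "\<And>u. u \<in> C \<Longrightarrow> (\<lambda>n. En n u u) \<longlonglongrightarrow> E u u"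
  shows "mosco_converges m En Fn E F"
proof -
  have sf: "symmetric_form m E F" and cl: "closed_form m E F"
    using assms(5) by (auto simp: dirichlet_form_def)
  have "extended_form E F v \<le> liminf (\<lambda>n. extended_form (En n) (Fn n) (u n))"
    if "L2_weak_conv m u v" for u v
  proof -
    have "extended_form E F (u n) \<le> extended_form (En n) (Fn n) (u n)" if "n \<ge> 1" for n
      using assms(7,8)[OF that] by (auto simp: extended_form_def)
    then have "liminf (\<lambda>n. extended_form E F (u n)) \<le> liminf (\<lambda>n. extended_form (En n) (Fn n) (u n))"
      by (intro Liminf_mono eventually_sequentiallyI[of 1])
    with extended_form_weakly_lsc[OF sf cl that] show ?thesis by (rule order_trans)
  qed
  moreover have "\<exists>u. L2_strong_conv m u v \<and>
      limsup (\<lambda>n. extended_form (En n) (Fn n) (u n)) \<le> extended_form E F v" if v: "v \<in> L2 m" for v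
  proof (cases "v \<in> F")
    case True
    have "\<exists>g\<in>C. form_one_norm m E (\<lambda>x. v x - g x) < \<epsilon>" if "0 < \<epsilon>" for \<epsilon>
      using assms(9) True that by (auto simp: is_core_def)
    moreover have "C \<subseteq> F" using assms(9) by (simp add: is_core_def)
    moreover have "eventually (\<lambda>n. C \<subseteq> Fn n) sequentially"
      by (rule eventually_sequentiallyI[of 1]) (use assms(10) in \<open>simp add: is_core_def\<close>)
    ultimately obtain u where "L2_strong_conv m u v"
      "limsup (\<lambda>n. extended_form (En n) (Fn n) (u n)) \<le> ereal (E v v)"
      using core_recovery_sequence[OF sf True, of C Fn En] assms(11) by blast
    then show ?thesis using True by (auto simp: extended_form_def)
  next
    case False
    \<comment> \<open>The limit form is infinite at \<open>v\<close>, so any strongly convergent sequence will do.\<close>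
    have "L2_strong_conv m (\<lambda>_. v) v"
      using v by (simp add: L2_strong_conv_def L2_norm_def L2_inner_def)
    then show ?thesis using False by (auto simp: extended_form_def)
  qed
  ultimately show ?thesis unfolding mosco_converges_def by blast
qed

end
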